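(* Let $x\in\mathbb{R}$ and assume that the sequence $\{B_{2n+1}^{*}(x)\}_{n\ge 0}$ is periodic. Then $x\in\{-3,-2,-1,0\}$ or $x=-\tfrac32$, where $B_{2n+1}^{*}\left(-\tfrac32\right)=0$ for all $n\ge 0$.
   Context: The Bernoulli polynomials $B_r(x)$ are defined by $\frac{te^{xt}}{e^t-1}=\sum_{r=0}^\infty B_r(x)\frac{t^r}{r!}$. For an integer $n>0$ the Zagier polynomial is $B_n^{*}(x)=\sum_{r=0}^{n}\binom{n+r}{2r}\frac{B_r(x)}{n+r}$. A sequence $\{a_n\}_{n\ge0}$ is periodic if there is an integer $p\ge1$ with $a_{n+p}=a_n$ for all $n\ge0$. *)

theory Defs
  imports "HOL-Analysis.Analysis" "HOL-Computational_Algebra.Formal_Power_Series"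
begin

text \<open>
  The Bernoulli polynomials, through their exponential generating function
  \<open>t * exp (x * t) / (exp t - 1)\<close> in the ring of formal power series in \<open>t\<close>. The formal
  division is exact, see \<open>bernpoly_egf_mult\<close>.
\<close>

definition bernpoly_egf :: "real \<Rightarrow> real fps" where
  "bernpoly_egf x = (fps_X * fps_exp x) / (fps_exp 1 - 1)"

lemma bernpoly_egf_mult: "bernpoly_egf x * (fps_exp 1 - 1) = fps_X * fps_exp x"
proof -
  have sd: "subdegree (fps_exp 1 - 1 :: real fps) = 1"
    by (rule subdegreeI) (auto simp del: subdegree_minus_commute)
  then have nz: "(fps_exp 1 - 1 :: real fps) \<noteq> 0"
    by (metis subdegree_0 zero_neq_one)
  have "(fps_exp 1 - 1 :: real fps) dvd fps_X * fps_exp x"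
    using nz by (subst fps_dvd_iff) (simp_all only: sd, simp_all add: fps_mult_fps_X_nonzero(1))
  then show ?thesis
    unfolding bernpoly_egf_def by simp
qed

definition bernpoly :: "nat \<Rightarrow> real \<Rightarrow> real" where
  "bernpoly r x = fact r * fps_nth (bernpoly_egf x) r"

text \<open>Only meaningful for \<open>n > 0\<close>: the summand \<open>r = 0\<close> is divided by \<open>n\<close>.\<close>

definition zagier_poly :: "nat \<Rightarrow> real \<Rightarrow> real" where
  "zagier_poly n x = (\<Sum>r=0..n. real ((n + r) choose (2 * r)) * (bernpoly r x / real (n + r)))"

definition periodic_seq :: "(nat \<Rightarrow> 'a) \<Rightarrow> bool" where
  "periodic_seq a \<longleftrightarrow> (\<exists>p\<ge>1. \<forall>n. a (n + p) = a n)"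

end

theory Submission
  imports Defs "HOL-Number_Theory.Cong"
begin

text \<open>
  Let \<open>L\<^sub>s\<close> be the linear functional \<open>X\<^sup>i \<mapsto> B\<^sub>i\<^sub>+\<^sub>1(s) / (i + 1)\<close> and \<open>u\<^sub>n(X) = U\<^sub>n\<^sub>-\<^sub>1(X/2)\<close>.
  The coefficients of \<open>u\<^sub>n(X + 2)\<close> are those in the definition of \<open>B\<^sub>n\<^sup>*\<close>, and
  \<open>L\<^sub>s\<^sub>+\<^sub>2(p) = L\<^sub>s(p(X + 2)) + \<integral>\<^sub>0\<^sup>2 p\<close> absorbs the term \<open>r = 0\<close> for odd \<open>n\<close>, so that
  \<open>2 B\<^sub>n\<^sup>*(x) = L\<^sub>s(u\<^sub>n)\<close> with \<open>s = x + 2\<close>.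

  If this is bounded for odd \<open>n\<close>, then expanding powers of \<open>X\<close> in the \<open>u\<^sub>n\<close> bounds
  \<open>B\<^sub>r(s) / r\<close> exponentially for odd \<open>r\<close>. Hence the odd part
  \<open>t (exp(s t) - exp((1 - s) t)) / (2 (exp t - 1))\<close> of the generating function is entire, and the
  absence of a pole at \<open>t = 2 \<pi> i\<close> forces \<open>2 x\<close> to be an integer.

  For such \<open>x\<close>, the reflection \<open>x \<mapsto> - 3 - x\<close> and \<open>B\<^sub>n\<^sup>*(x + 1) - B\<^sub>n\<^sup>*(x) = u\<^sub>n(x + 2) / 2\<close>
  give \<open>B\<^sub>n\<^sup>*(x)\<close> as a finite sum of values of \<open>u\<^sub>n\<close>. It is unbounded if \<open>x \<ge> 1\<close>, since
  \<open>u\<^sub>n(c) \<ge> n\<close> for \<open>c \<ge> 2\<close>; for \<open>x = \<plusminus>1/2\<close> its 2-adic valuation tends to \<open>-\<infinity>\<close>.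
\<close>

subsection \<open>Bernoulli polynomials\<close>

lemma fps_exp_minus_one_nonzero: "(fps_exp 1 - 1 :: real fps) \<noteq> 0"
proof
  assume "(fps_exp 1 - 1 :: real fps) = 0"
  then have "fps_nth (fps_exp 1 - 1 :: real fps) 1 = 0" by simp
  then show False by simp
qed

lemma bernpoly_egf_add: "bernpoly_egf (x + c) = bernpoly_egf x * fps_exp c"
proof -
  have "bernpoly_egf (x + c) * (fps_exp 1 - 1) = (bernpoly_egf x * fps_exp c) * (fps_exp 1 - 1)"
    using bernpoly_egf_mult[of x] bernpoly_egf_mult[of "x + c"]
    by (simp add: fps_exp_add_mult mult.assoc mult.commute mult.left_commute)
  then show ?thesis
    using fps_exp_minus_one_nonzero by simp
qed

text \<open>Putting -t for t in the defining product yields the factor exp(-t) - 1; multiplying by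
  -exp t turns it into exp t - 1 and the exponent -s into 1 - s.\<close>

lemma bernpoly_egf_reflect:
  "fps_compose (bernpoly_egf s) (- fps_X) = bernpoly_egf (1 - s)"
proof -
  let ?G = "fps_compose (bernpoly_egf s) (- fps_X)"
  have "fps_compose (bernpoly_egf s * (fps_exp 1 - 1)) (- fps_X) = 
    fps_compose (fps_X * fps_exp s) (- fps_X)"
    by (simp only: bernpoly_egf_mult)
  then have 1: "?G * (fps_exp (-1) - 1) = - fps_X * fps_exp (- s)"
    by (simp add: fps_compose_mult_distrib fps_compose_sub_distrib)
  have e: "fps_exp (-1) * fps_exp 1 = (1 :: real fps)"
    by (simp add: fps_exp_add_mult[symmetric])
  have "?G * (fps_exp 1 - 1) = - (?G * (fps_exp (-1) - 1)) * fps_exp 1"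
    using e by (simp add: algebra_simps)
  also have "\<dots> = fps_X * (fps_exp (- s) * fps_exp 1)"
    unfolding 1 by (simp add: algebra_simps)
  also have "\<dots> = fps_X * fps_exp (1 - s)"
    by (simp add: fps_exp_add_mult[symmetric])
  also have "\<dots> = bernpoly_egf (1 - s) * (fps_exp 1 - 1)"
    by (simp add: bernpoly_egf_mult)
  finally show ?thesis
    using fps_exp_minus_one_nonzero by simp
qed

lemma bernpoly_reflect: "bernpoly r (1 - s) = (-1) ^ r * bernpoly r s"
  unfolding bernpoly_def bernpoly_egf_reflect[symmetric]
  by (simp add: fps_compose_uminus' )

lemma bernpoly_0 [simp]: "bernpoly 0 x = 1"
proof -
  have "fps_nth (bernpoly_egf x * (fps_exp 1 - 1)) 1 = fps_nth (fps_X * fps_exp x) 1"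
    by (simp only: bernpoly_egf_mult)
  then show ?thesis
    by (simp add: bernpoly_def fps_mult_nth)
qed

lemma bernpoly_Suc_add_one: "bernpoly (Suc r) (s + 1) = bernpoly (Suc r) s + real (Suc r) * s ^ r"
proof -
  have "bernpoly_egf (s + 1) = bernpoly_egf s + fps_X * fps_exp s"
    unfolding bernpoly_egf_add[of s 1] using bernpoly_egf_mult[of s] by (simp add: algebra_simps)
  then show ?thesis
    by (simp add: bernpoly_def field_simps)
qed

lemma bernpoly_add:
  "bernpoly r (x + c) = (\<Sum>k\<le>r. real (r choose k) * bernpoly k x * c ^ (r - k))"
  unfolding bernpoly_def bernpoly_egf_add fps_mult_nth atLeast0AtMost sum_distrib_left
  by (intro sum.cong) (simp_all add: binomial_fact field_simps)

subsection \<open>A linear functional\<close>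

text \<open>Umbrally: take the antiderivative of \<open>p\<close> vanishing at 0 and replace each
  X^r by B_r(s).\<close>

definition bern_fun :: "real \<Rightarrow> real poly \<Rightarrow> real" where
  "bern_fun s p = (\<Sum>i\<le>degree p. coeff p i * (bernpoly (Suc i) s / real (Suc i)))"

lemma bern_fun_altdef:
  assumes "degree p \<le> N"
  shows "bern_fun s p = (\<Sum>i\<le>N. coeff p i * (bernpoly (Suc i) s / real (Suc i)))"
  unfolding bern_fun_def using assms
  by (intro sum.mono_neutral_left) (auto simp: coeff_eq_0)

lemma bern_fun_add: "bern_fun s (p + q) = bern_fun s p + bern_fun s q"
proof -
  let ?N = "max (degree p) (degree q)"
  have "degree (p + q) \<le> ?N" "degree p \<le> ?N" "degree q \<le> ?N"
    by (auto intro: degree_add_le)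
  then show ?thesis
    by (simp add: bern_fun_altdef[of _ ?N] sum.distrib ring_distribs add_divide_distrib)
qed

lemma bern_fun_smult: "bern_fun s (smult a p) = a * bern_fun s p"
  using bern_fun_altdef[OF degree_smult_le, of s a p]
  by (simp add: bern_fun_def sum_distrib_left mult.assoc)

lemma bern_fun_0 [simp]: "bern_fun s 0 = 0"
  by (simp add: bern_fun_def)

lemma bern_fun_sum: "bern_fun s (\<Sum>i\<in>A. f i) = (\<Sum>i\<in>A. bern_fun s (f i))"
  by (induction A rule: infinite_finite_induct) (simp_all add: bern_fun_add)

lemma bern_fun_power: "bern_fun s ([:0, 1:] ^ i) = bernpoly (Suc i) s / real (Suc i)"
proof -
  have "bern_fun s ([:0, 1:] ^ i) = (\<Sum>k\<le>i. if k = i then bernpoly (Suc k) s / real (Suc k) else 0)"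
    unfolding bern_fun_altdef[OF order.refl] degree_linear_power
    by (intro sum.cong refl) (auto simp: coeff_linear_poly_power power_0_left)
  then show ?thesis by simp
qed

lemma bern_fun_add_one: "bern_fun (s + 1) p = bern_fun s p + poly p s"
  unfolding bern_fun_def poly_altdef sum.distrib[symmetric] bernpoly_Suc_add_one
  by (intro sum.cong refl) (simp add: add_divide_distrib ring_distribs del: of_nat_Suc)

text \<open>In the binomial expansion of B_{i+1}(x + c), the term of B_0 = 1 gives the integral of
  X^i over [0, c]; absorption of i + 1 into the binomials matches the rest.\<close>

lemma bern_fun_shift_power:
  "bern_fun (x + c) ([:0, 1:] ^ i) = bern_fun x ([:c, 1:] ^ i) + c ^ Suc i / real (Suc i)"
proof -
  have *: "real (Suc i choose Suc k) / real (Suc i) = real (i choose k) / real (Suc k)" for k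
  proof -
    have "real (Suc k) * real (Suc i choose Suc k) = real (Suc i) * real (i choose k)"
      using Suc_times_binomial_eq[of i k] by (metis of_nat_mult mult.commute)
    then show ?thesis by (simp add: field_simps del: of_nat_Suc)
  qed
  have "bern_fun x ([:c, 1:] ^ i) = 
      (\<Sum>k\<le>i. real (i choose k) / real (Suc k) * (bernpoly (Suc k) x * c ^ (i - k)))"
    by (simp add: bern_fun_altdef[of _ i] degree_linear_power coeff_linear_poly_power mult_ac)
  also have "\<dots> = (\<Sum>k\<le>i. real (Suc i choose Suc k) * bernpoly (Suc k) x * c ^ (i - k)) / real (Suc i)"
    unfolding *[symmetric] sum_divide_distrib by (intro sum.cong) (simp_all add: mult_ac)
  finally show ?thesis
    unfolding bern_fun_power bernpoly_add
    by (simp add: sum.atMost_Suc_shift add_divide_distrib del: of_nat_Suc sum.atMost_Suc binomial_Suc_Suc)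
qed

lemma bern_fun_shift:
  "bern_fun (x + c) p = bern_fun x (p \<circ>\<^sub>p [:c, 1:]) + (\<Sum>i\<le>degree p. coeff p i * (c ^ Suc i / real (Suc i)))"
proof -
  have p: "p \<circ>\<^sub>p [:c, 1:] = (\<Sum>i\<le>degree p. smult (coeff p i) ([:c, 1:] ^ i))"
    by (intro poly_eq_poly_eq_iff[THEN iffD1]) (simp add: fun_eq_iff poly_pcompose poly_altdef[of p] poly_sum)
  have "bern_fun (x + c) p = (\<Sum>i\<le>degree p. coeff p i * bern_fun (x + c) ([:0, 1:] ^ i))"
    unfolding bern_fun_power by (simp add: bern_fun_def)
  then show ?thesis
    unfolding p bern_fun_sum bern_fun_smult bern_fun_shift_power
    by (simp add: sum.distrib ring_distribs)
qed

lemma sum_coeff_pderiv: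
  "(\<Sum>i\<le>degree (pderiv q). coeff (pderiv q) i * (c ^ Suc i / real (Suc i))) = poly q c - poly q (0::real)"
proof (cases "degree q")
  case 0
  then obtain a where "q = [:a:]" by (metis degree_eq_zeroE)
  then show ?thesis by (simp add: pderiv_pCons)
next
  case (Suc d)
  then have "degree (pderiv q) = d" by (simp add: degree_pderiv)
  then have "(\<Sum>i\<le>degree (pderiv q). coeff (pderiv q) i * (c ^ Suc i / real (Suc i))) =
     (\<Sum>i\<le>d. coeff q (Suc i) * c ^ Suc i)"
    by (intro sum.cong) (simp_all add: coeff_pderiv del: of_nat_Suc)
  then show ?thesis
    using Suc by (simp add: poly_altdef[of q c] sum.atMost_Suc_shift poly_0_coeff_0 del: sum.atMost_Suc)
qed

subsection \<open>Chebyshev polynomials\<close>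

text \<open>In the usual normalisation these are \<open>U\<^sub>n\<^sub>-\<^sub>1(X/2)\<close> and \<open>2 T\<^sub>n(X/2)\<close>.\<close>
fun cheb_U :: "nat \<Rightarrow> real poly" where
  "cheb_U 0 = 0"
| "cheb_U (Suc 0) = 1"
| "cheb_U (Suc (Suc n)) = [:0, 1:] * cheb_U (Suc n) - cheb_U n"

fun cheb_T :: "nat \<Rightarrow> real poly" where
  "cheb_T 0 = 2"
| "cheb_T (Suc 0) = [:0, 1:]"
| "cheb_T (Suc (Suc n)) = [:0, 1:] * cheb_T (Suc n) - cheb_T n"

lemma cheb_T_Suc: "cheb_T (Suc n) = cheb_U (Suc (Suc n)) - cheb_U n"
proof (induction n rule: cheb_U.induct)
  case (3 n)
  show ?case
    unfolding cheb_T.simps(3)[of "Suc n"] 3 by (simp add: algebra_simps del: mult_pCons_left mult_pCons_right)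
qed (simp_all add: numeral_poly)

text \<open>Supplies an explicit antiderivative of \<open>cheb_U n\<close> for n > 0, so that the
  integral arising from the shift can be evaluated.\<close>

lemma pderiv_cheb_T: "pderiv (cheb_T n) = of_nat n * cheb_U n"
proof (induction n rule: cheb_T.induct)
  case (3 n)
  have "pderiv (cheb_T (Suc (Suc n))) - of_nat (Suc (Suc n)) * cheb_U (Suc (Suc n)) =
      cheb_T (Suc n) - [:0, 1:] * cheb_U (Suc n) + 2 * cheb_U n"
    using 3 by (simp add: pderiv_diff pderiv_mult pderiv_pCons algebra_simps)
  also have "\<dots> = 0"
    unfolding cheb_T_Suc by simp
  finally show ?case by simp
qed (simp_all add: pderiv_pCons flip: numeral_poly)

lemma poly_cheb_T_2: "poly (cheb_T n) 2 = 2"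
  by (induction n rule: cheb_T.induct) simp_all

lemma poly_cheb_T_odd_0: "odd n \<Longrightarrow> poly (cheb_T n) 0 = 0"
  by (induction n rule: cheb_T.induct) simp_all

lemma degree_cheb_U: "degree (cheb_U n) \<le> n - 1"
proof (induction n rule: cheb_U.induct)
  case (3 n)
  show ?case
    using 3 degree_mult_le[of "[:0, 1:]" "cheb_U (Suc n)"]
    by (auto intro!: degree_diff_le)
qed simp_all

text \<open>After the shift, the recurrence reads u_{n+2} - 2 u_{n+1} + u_n = X u_{n+1}; on
  coefficients this is Pascal's rule applied twice.\<close>

lemma coeff_cheb_U_shift: "coeff (cheb_U n \<circ>\<^sub>p [:2, 1:]) i = real ((n + i) choose (2 * i + 1))"
proof (induction n arbitrary: i rule: cheb_U.induct)
  case (2 i)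
  show ?case by (cases i) (simp_all add: coeff_1 pcompose_1 binomial_eq_0)
next
  case (3 n)
  have *: "cheb_U (Suc (Suc n)) \<circ>\<^sub>p [:2, 1:] =
      pCons 0 (cheb_U (Suc n) \<circ>\<^sub>p [:2, 1:]) + smult 2 (cheb_U (Suc n) \<circ>\<^sub>p [:2, 1:]) - cheb_U n \<circ>\<^sub>p [:2, 1:]"
    by (simp add: pcompose_diff pcompose_mult pcompose_pCons)
  show ?case
  proof (cases i)
    case 0
    then show ?thesis unfolding * coeff_diff coeff_add coeff_smult 3 by simp
  next
    case (Suc j)
    show ?thesis unfolding * coeff_diff coeff_add coeff_smult 3 Suc coeff_pCons_Suc by simp
  qed
qed (simp add: binomial_eq_0)

lemma poly_cheb_U_Suc_Suc:
  "poly (cheb_U (Suc (Suc n))) c = c * poly (cheb_U (Suc n)) c - poly (cheb_U n) c"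
  by simp

section \<open>Zagier polynomials through the functional\<close>

lemma zagier_poly_altdef:
  assumes "n > 0"
  shows "zagier_poly n x = 1 / real n + bern_fun x (cheb_U n \<circ>\<^sub>p [:2, 1:]) / 2"
proof -
  obtain m where n: "n = Suc m" using assms by (cases n) auto
  \<comment> \<open>Absorption with r = i + 1 removes the denominator n + r and leaves the weight 1
    / (2 r); the term r = 0 is the separate 1 / n.\<close>
  have *: "real ((n + Suc i) choose (2 * Suc i)) / real (n + Suc i) = 
      real ((n + i) choose (2 * i + 1)) / (2 * real (Suc i))" for i
  proof -
    have "(2 * Suc i) * ((n + Suc i) choose (2 * Suc i)) = (n + Suc i) * ((n + i) choose (2 * i + 1))"
      using Suc_times_binomial_eq[of "n + i" "2 * i + 1"]
      by (simp add: mult.commute del: binomial_Suc_Suc)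
    then have "real ((n + Suc i) choose (2 * Suc i)) * (2 * real (Suc i)) =
        real ((n + i) choose (2 * i + 1)) * real (n + Suc i)"
      by (metis of_nat_mult of_nat_numeral mult.commute)
    then show ?thesis by (subst frac_eq_eq) (simp_all del: of_nat_Suc of_nat_add binomial_Suc_Suc)
  qed
  have deg: "degree (cheb_U n \<circ>\<^sub>p [:2, 1:]) \<le> m"
    using degree_cheb_U[of n] n by (simp add: degree_pcompose)
  have "zagier_poly n x = 1 / real n +
      (\<Sum>i\<le>m. real ((n + Suc i) choose (2 * Suc i)) * (bernpoly (Suc i) x / real (n + Suc i)))"
    unfolding zagier_poly_def atLeast0AtMost
    by (subst (2) n, subst sum.atMost_Suc_shift) simp
  also have "(\<Sum>i\<le>m. real ((n + Suc i) choose (2 * Suc i)) * (bernpoly (Suc i) x / real (n + Suc i))) =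
      bern_fun x (cheb_U n \<circ>\<^sub>p [:2, 1:]) / 2"
    unfolding bern_fun_altdef[OF deg] sum_divide_distrib
  proof (intro sum.cong refl)
    fix i
    show "real ((n + Suc i) choose (2 * Suc i)) * (bernpoly (Suc i) x / real (n + Suc i)) =
      coeff (cheb_U n \<circ>\<^sub>p [:2, 1:]) i * (bernpoly (Suc i) x / real (Suc i)) / 2"
      using *[of i] unfolding coeff_cheb_U_shift by (simp add: field_simps del: binomial_Suc_Suc of_nat_Suc)
  qed
  finally show ?thesis .
qed

lemma zagier_poly_odd:
  assumes "odd n"
  shows "zagier_poly n x = bern_fun (x + 2) (cheb_U n) / 2"
proof -
  from assms have n: "n > 0" by (rule odd_pos)
  have "cheb_U n = pderiv (smult (1 / real n) (cheb_T n))"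
    using n by (simp add: pderiv_smult pderiv_cheb_T of_nat_poly)
  \<comment> \<open>The integral over [0, 2] is (\<open>cheb_T n\<close> at 2 minus at 0) / n; half
    of it is exactly the term r = 0.\<close>
  then have "(\<Sum>i\<le>degree (cheb_U n). coeff (cheb_U n) i * (2 ^ Suc i / real (Suc i))) = 2 / real n"
    using assms by (simp only: sum_coeff_pderiv) (simp add: poly_cheb_T_2 poly_cheb_T_odd_0)
  then show ?thesis
    using bern_fun_shift[of x 2 "cheb_U n"] by (simp add: zagier_poly_altdef[OF n] add_divide_distrib)
qed

lemma zagier_poly_odd_add_one:
  assumes "odd n"
  shows "zagier_poly n (x + 1) = zagier_poly n x + poly (cheb_U n) (x + 2) / 2"
  using bern_fun_add_one[of "x + 2" "cheb_U n"]
  by (simp add: zagier_poly_odd[OF assms] add_divide_distrib algebra_simps)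

lemma coeff_cheb_U_eq_0: "even (n + i) \<Longrightarrow> coeff (cheb_U n) i = 0"
proof (induction n arbitrary: i rule: cheb_U.induct)
  case (3 n i)
  then show ?case by (cases i) simp_all
qed (auto simp: coeff_1 odd_pos)

text \<open>For odd n only even powers occur in \<open>cheb_U n\<close>, so only Bernoulli
  polynomials of odd index enter, and these change sign under s \<mapsto> 1 - s with s = x +
  2.\<close>

lemma zagier_poly_odd_reflect:
  assumes "odd n"
  shows "zagier_poly n (- 3 - x) = - zagier_poly n x"
proof -
  have "bern_fun (1 - (x + 2)) (cheb_U n) = - bern_fun (x + 2) (cheb_U n)"
    unfolding bern_fun_def sum_negf[symmetric]
  proof (intro sum.cong refl)
    fix i
    show "coeff (cheb_U n) i * (bernpoly (Suc i) (1 - (x + 2)) / real (Suc i)) =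
      - (coeff (cheb_U n) i * (bernpoly (Suc i) (x + 2) / real (Suc i)))"
      using assms coeff_cheb_U_eq_0[of n i] unfolding bernpoly_reflect
      by (cases "even i") auto
  qed
  then show ?thesis
    by (simp add: zagier_poly_odd[OF assms] algebra_simps)
qed

lemma zagier_poly_odd_center:
  assumes "odd n"
  shows "zagier_poly n (- 3 / 2) = 0"
  using zagier_poly_odd_reflect[OF assms, of "- 3 / 2"] by simp

subsection \<open>Bounded sequences\<close>

text \<open>Since X u_n = u_{n+1} + u_{n-1}, each factor X at most doubles the bound. The parity
  condition makes every expansion end in odd indices; n = 1 bounds the functional on even
  powers.\<close>

lemma abs_bern_fun_power_mult_cheb_U_le:
  assumes M: "\<And>n. odd n \<Longrightarrow> \<bar>bern_fun s (cheb_U n)\<bar> \<le> M"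
  assumes "odd (n + j)"
  shows "\<bar>bern_fun s ([:0, 1:] ^ j * cheb_U n)\<bar> \<le> M * 2 ^ j"
  using assms(2)
proof (induction j arbitrary: n)
  case 0
  then show ?case using M by simp
next
  case (Suc j)
  have "M \<ge> 0" using M[of 1] by fastforce
  show ?case
  proof (cases n)
    case 0
    then show ?thesis using \<open>M \<ge> 0\<close> by simp
  next
    case (Suc k)
    then have "[:0, 1:] ^ Suc j * cheb_U n = [:0, 1:] ^ j * cheb_U (Suc n) + [:0, 1:] ^ j * cheb_U k"
      by (simp add: algebra_simps)
    then show ?thesis
      using Suc.IH[of "Suc n"] Suc.IH[of k] Suc.prems Suc by (simp add: bern_fun_add)
  qed
qed

section \<open>Convergence at 2 pi i\<close>

lemma fps_exp_sums: "(\<lambda>n. complex_of_real (fps_nth (fps_exp s) n) * t ^ n) sums exp (of_real s * t)"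
  using exp_converges[of "of_real s * t"] by (simp add: scaleR_conv_of_real power_mult_distrib divide_inverse mult_ac)

lemma fps_mult_sums:
  fixes f g :: "real fps" and t :: complex
  assumes "summable (\<lambda>n. norm (of_real (fps_nth f n) * t ^ n))" "summable (\<lambda>n. norm (of_real (fps_nth g n) * t ^ n))"
  shows "(\<lambda>n. of_real (fps_nth (f * g) n) * t ^ n) sums
    ((\<Sum>n. of_real (fps_nth f n) * t ^ n) * (\<Sum>n. of_real (fps_nth g n) * t ^ n))"
proof -
  have "of_real (fps_nth (f * g) n) * t ^ n = (\<Sum>i\<le>n. (of_real (fps_nth f i) * t ^ i) * (of_real (fps_nth g (n - i)) * t ^ (n - i)))" for n
    unfolding fps_mult_nth of_real_sum sum_distrib_right atLeast0AtMost
    by (intro sum.cong refl) (simp add: mult_ac flip: power_add)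
  then show ?thesis
    using Cauchy_product_sums[OF assms] by simp
qed

lemma bounded_imp_half_integer:
  assumes M: "\<And>n. odd n \<Longrightarrow> \<bar>bern_fun s (cheb_U n)\<bar> \<le> M"
  shows "\<exists>k::int. 2 * s = of_int k"
proof -
  \<comment> \<open>By reflection this is twice the odd part of the generating function, the part
    that the hypothesis controls; \<open>t\<close> is a zero of exp t - 1.\<close>
  define D where "D = bernpoly_egf s - bernpoly_egf (1 - s)"
  define t :: complex where "t = of_real (2 * pi) * \<i>"
  have "M \<ge> 0" using M[of 1] by fastforce
  have D: "fps_nth D r = (1 - (-1) ^ r) * bernpoly r s / fact r" for r
    using bernpoly_reflect[of r s] by (simp add: D_def bernpoly_def field_simps)
  have bound: "\<bar>fps_nth D r\<bar> \<le> 2 * M * (1 / fact (r - 1)) * 2 ^ (r - 1)" for r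
  proof (cases "odd r")
    case True
    then obtain i where i: "r = Suc i" "even i" by (cases r) auto
    have "\<bar>bernpoly r s\<bar> = real r * \<bar>bern_fun s ([:0, 1:] ^ i)\<bar>"
      unfolding bern_fun_power i(1) by (simp add: abs_mult del: of_nat_Suc)
    also have "\<dots> \<le> real r * (M * 2 ^ i)"
      using abs_bern_fun_power_mult_cheb_U_le[OF M, of 1 i] i by (intro mult_left_mono) auto
    finally have "\<bar>bernpoly r s\<bar> \<le> real r * (M * 2 ^ i)" .
    then have "\<bar>fps_nth D r\<bar> \<le> 2 * (real r * (M * 2 ^ i)) / fact r"
      using True by (simp add: D abs_mult divide_right_mono)
    also have "\<dots> = 2 * M * (1 / fact (r - 1)) * 2 ^ (r - 1)"
      unfolding i(1) fact_Suc by (simp add: field_simps del: of_nat_Suc)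
    finally show ?thesis .
  next
    case False
    then show ?thesis using \<open>M \<ge> 0\<close> by (simp add: D)
  qed
  have sumD: "summable (\<lambda>n. norm (of_real (fps_nth D n) * t ^ n))"
  proof -
    have "summable (\<lambda>n. 2 * M * norm t * ((2 * norm t) ^ n /\<^sub>R fact n))"
      by (intro summable_mult summable_exp_generic)
    then have "summable (\<lambda>n. norm (of_real (fps_nth D (Suc n)) * t ^ Suc n))"
    proof (rule summable_comparison_test'[where N = 0])
      fix n :: nat
      have "\<bar>fps_nth D (Suc n)\<bar> * norm t ^ Suc n \<le> (2 * M * (1 / fact n) * 2 ^ n) * norm t ^ Suc n"
        using bound[of "Suc n"] by (intro mult_right_mono) auto
      then show "norm (norm (of_real (fps_nth D (Suc n)) * t ^ Suc n)) \<le> 2 * M * norm t * ((2 * norm t) ^ n /\<^sub>R fact n)"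
        by (simp add: norm_mult norm_power power_mult_distrib divide_inverse mult_ac)
    qed
    then show ?thesis by (subst (asm) summable_Suc_iff)
  qed
  have sum_exp: "summable (\<lambda>n. norm (of_real (fps_nth (fps_exp c) n) * t ^ n))" for c :: real
    using summable_norm_exp[of "of_real c * t"]
    by (simp add: scaleR_conv_of_real power_mult_distrib divide_inverse mult_ac)
  have "D * (fps_exp 1 - 1) = fps_X * (fps_exp s - fps_exp (1 - s))"
    by (simp add: D_def left_diff_distrib right_diff_distrib[of fps_X] bernpoly_egf_mult)
  then have eq: "D * fps_exp 1 = D + fps_X * (fps_exp s - fps_exp (1 - s))"
    by (simp add: algebra_simps)
  have t: "exp t = 1" by (simp add: t_def exp_eq_polar)
  have "(\<lambda>n. of_real (fps_nth (D * fps_exp 1) n) * t ^ n) sums ((\<Sum>n. of_real (fps_nth D n) * t ^ n) * exp t)"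
    using fps_mult_sums[OF sumD sum_exp[of 1]] fps_exp_sums[of 1 t] by (simp add: sums_iff)
  then have 1: "(\<lambda>n. of_real (fps_nth (D * fps_exp 1) n) * t ^ n) sums (\<Sum>n. of_real (fps_nth D n) * t ^ n)"
    by (simp add: t)
  have 2: "(\<lambda>n. of_real (fps_nth D n) * t ^ n) sums (\<Sum>n. of_real (fps_nth D n) * t ^ n)"
    using sumD by (intro summable_sums) (rule summable_norm_cancel)
  \<comment> \<open>As exp t = 1, the series of \<open>D * fps_exp 1\<close> and of \<open>D\<close>
    have the same sum at \<open>t\<close>, so the numerator of \<open>D\<close> vanishes
    there.\<close>
  have "(\<lambda>n. of_real (fps_nth (fps_X * (fps_exp s - fps_exp (1 - s))) n) * t ^ n) sums 0"
    using sums_diff[OF 1 2] by (simp add: eq ring_distribs)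
  then have "(\<lambda>n. of_real (fps_nth (fps_X * (fps_exp s - fps_exp (1 - s))) (Suc n)) * t ^ Suc n) sums 0"
    by (intro sums_Suc_iff[THEN iffD2]) simp
  moreover have "(\<lambda>n. of_real (fps_nth (fps_X * (fps_exp s - fps_exp (1 - s))) (Suc n)) * t ^ Suc n) sums
      (t * (exp (of_real s * t) - exp (of_real (1 - s) * t)))"
    using sums_mult[OF sums_diff[OF fps_exp_sums[of s t] fps_exp_sums[of "1 - s" t]], of t]
    by (simp add: algebra_simps)
  ultimately have "t * (exp (of_real s * t) - exp (of_real (1 - s) * t)) = 0"
    using sums_unique2 by blast
  moreover have "t \<noteq> 0" by (simp add: t_def)
  ultimately have "exp (of_real s * t) = exp (of_real (1 - s) * t)" by simp
  then obtain k :: int where "of_real s * t = of_real (1 - s) * t + of_real (2 * of_int k * pi) * \<i>"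
    by (auto simp: exp_eq)
  then have "Im (of_real s * t) = Im (of_real (1 - s) * t + of_real (2 * of_int k * pi) * \<i>)" by simp
  then have "2 * pi * (2 * s) = 2 * pi * of_int (k + 1)"
    by (simp add: t_def algebra_simps)
  then have "2 * s = of_int (k + 1)" by simp
  then show ?thesis by blast
qed

section \<open>Arithmetic and size of Chebyshev values; periodicity\<close>

text \<open>At half an odd number, \<open>2\<^sup>n\<^sup>-\<^sup>1\<close> clears the denominators of \<open>cheb_U n\<close>.\<close>
fun cheb_U_num :: "int \<Rightarrow> nat \<Rightarrow> int" where
  "cheb_U_num q 0 = 0"
| "cheb_U_num q (Suc 0) = 1"
| "cheb_U_num q (Suc (Suc n)) = q * cheb_U_num q (Suc n) - 4 * cheb_U_num q n"

lemma poly_cheb_U_half: "2 ^ n * poly (cheb_U n) (of_int q / 2) = 2 * of_int (cheb_U_num q n)"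
  by (induction n rule: cheb_U.induct) (simp_all add: algebra_simps)

text \<open>Modulo 4 the recurrence is multiplication by q, so the value is q^(n-1), an even power
  of an odd number.\<close>

lemma cheb_U_num_mod_4:
  assumes "odd q" "odd n"
  shows "cheb_U_num q n mod 4 = 1"
proof -
  have "[cheb_U_num q (Suc m) = q ^ m] (mod 4)" for m
  proof (induction m rule: cheb_U.induct)
    case (3 m)
    have "[q * cheb_U_num q (Suc (Suc m)) - 4 * cheb_U_num q (Suc m) = q * q ^ Suc m - 0] (mod 4)"
      by (intro cong_diff cong_mult cong_refl 3) (simp add: cong_0_iff)
    then show ?case by simp
  qed (simp_all add: cong_def)
  moreover obtain j where j: "n = Suc (2 * j)"
    using assms(2) by (auto elim!: oddE)
  moreover have "[(q ^ 2) ^ j = 1 ^ j] (mod 4)"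
  proof (rule cong_pow)
    obtain k where "q = 2 * k + 1" using assms(1) by (rule oddE)
    then have "q ^ 2 - 1 = 4 * (k * k + k)" by (simp add: power2_eq_square algebra_simps)
    then show "[q ^ 2 = 1] (mod 4)" by (simp add: cong_iff_dvd_diff)
  qed
  ultimately have "[cheb_U_num q n = 1] (mod 4)"
    by (metis cong_trans power_mult power_one)
  then show ?thesis by (simp add: cong_def)
qed

lemma poly_cheb_U_ge:
  assumes "c \<ge> 2"
  shows "poly (cheb_U n) c \<ge> real n"
proof -
  \<comment> \<open>The induction also carries the increments: for c \<ge> 2 they do not decrease,
    and the first is 1.\<close>
  have "poly (cheb_U n) c \<ge> real n \<and> poly (cheb_U (Suc n)) c \<ge> poly (cheb_U n) c + 1"
  proof (induction n)
    case (Suc n)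
    have "poly (cheb_U (Suc n)) c \<ge> 0" using Suc by linarith
    then have "2 * poly (cheb_U (Suc n)) c \<le> c * poly (cheb_U (Suc n)) c"
      using assms by (rule mult_right_mono[rotated])
    then show ?case using Suc by (simp only: poly_cheb_U_Suc_Suc) linarith
  qed simp
  then show ?thesis by simp
qed

lemma abs_poly_cheb_U_le:
  assumes "0 \<le> c" "c \<le> 3 / 2"
  shows "\<bar>poly (cheb_U n) c\<bar> \<le> 2"
proof -
  define u where "u n = poly (cheb_U n) c" for n
  \<comment> \<open>A conserved quadratic form of the recurrence, positive definite for |c| < 2.
    Completing the square gives (1 - c^2/4) u_n^2 \<le> 1, hence u_n^2 \<le> 16/7 for the given
    c.\<close>
  have inv: "u (Suc n) ^ 2 - c * u n * u (Suc n) + u n ^ 2 = 1" for n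
    by (induction n) (simp_all add: u_def power2_eq_square algebra_simps)
  have "c ^ 2 \<le> (3 / 2) ^ 2" using assms by (intro power_mono)
  then have "c ^ 2 * u n ^ 2 \<le> 9 / 4 * u n ^ 2"
    by (intro mult_right_mono) (simp_all add: power_divide)
  moreover have "(u (Suc n) - c / 2 * u n) ^ 2 \<ge> 0" by simp
  moreover have "(u (Suc n) - c / 2 * u n) ^ 2 = 1 - u n ^ 2 + c ^ 2 * u n ^ 2 / 4"
    using inv[of n] by (simp add: power2_eq_square algebra_simps)
  ultimately have "u n ^ 2 \<le> 4" by linarith
  then have "u n ^ 2 \<le> 2 ^ 2" by simp
  then show ?thesis
    unfolding u_def by (metis abs_le_square_iff abs_numeral)
qed

lemma periodic_seq_mult:
  fixes a :: "nat \<Rightarrow> 'a"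
  assumes "\<forall>n. a (n + p) = a n"
  shows "a (n + k * p) = a n"
proof (induction k)
  case (Suc k)
  have "a (n + Suc k * p) = a ((n + k * p) + p)" by (simp add: algebra_simps)
  with Suc assms show ?case by simp
qed simp

lemma periodic_seq_bounded:
  fixes a :: "nat \<Rightarrow> real"
  assumes "periodic_seq a"
  shows "\<exists>M. \<forall>n. \<bar>a n\<bar> \<le> M"
proof -
  from assms obtain p where p: "p \<ge> 1" "\<forall>n. a (n + p) = a n"
    unfolding periodic_seq_def by blast
  have "\<bar>a n\<bar> \<le> Max ((\<lambda>i. \<bar>a i\<bar>) ` {..<p})" for n
  proof -
    have "a n = a (n mod p)"
      using periodic_seq_mult[OF p(2), of "n mod p" "n div p"] by simp
    then show ?thesis using p(1) by (auto intro!: Max_ge)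
  qed
  then show ?thesis by blast
qed

subsection \<open>Half-integral arguments\<close>

lemma zagier_poly_odd_step:
  assumes "odd n"
  shows "zagier_poly n (c - 1) = zagier_poly n (c - 2) + poly (cheb_U n) c / 2"
  using zagier_poly_odd_add_one[OF assms, of "c - 2"] by simp

text \<open>The points -1 and -2 are exchanged by the reflection and differ by one step, which
  determines both values.\<close>

lemma zagier_poly_minus_1:
  assumes "odd n"
  shows "zagier_poly n (-1) = poly (cheb_U n) 0 / 4"
  using zagier_poly_odd_step[OF assms, of 0] zagier_poly_odd_reflect[OF assms, of "-1"] by simp

lemma zagier_poly_0:
  assumes "odd n"
  shows "zagier_poly n 0 = poly (cheb_U n) 0 / 4 + poly (cheb_U n) 1 / 2"
  using zagier_poly_odd_step[OF assms, of 1] zagier_poly_minus_1[OF assms] by simp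

lemma zagier_poly_minus_half:
  assumes "odd n"
  shows "zagier_poly n (- 1 / 2) = poly (cheb_U n) (1 / 2) / 2"
  using zagier_poly_odd_step[OF assms, of "1 / 2"] zagier_poly_odd_center[OF assms] by simp

lemma zagier_poly_half:
  assumes "odd n"
  shows "zagier_poly n (1 / 2) = poly (cheb_U n) (1 / 2) / 2 + poly (cheb_U n) (3 / 2) / 2"
  using zagier_poly_odd_step[OF assms, of "3 / 2"] zagier_poly_minus_half[OF assms] by simp

text \<open>Induction in unit steps of the argument, two steps of \<open>k\<close>. The starting
  values at 0 and 1/2 are at least -3/2 and -2, and each step adds at least n/2.\<close>

lemma zagier_poly_odd_lower_bound:
  assumes n: "odd n"
  shows "zagier_poly n (real k / 2 + 1) \<ge> real n / 2 - 2"
proof (induction k rule: nat_less_induct)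
  case (1 k)
  have step: "zagier_poly n (real k / 2 + 1) = zagier_poly n (real k / 2) + poly (cheb_U n) (real k / 2 + 2) / 2"
    using zagier_poly_odd_step[OF n, of "real k / 2 + 2"] by (simp add: add.commute)
  have ge: "poly (cheb_U n) (real k / 2 + 2) \<ge> real n" by (rule poly_cheb_U_ge) simp
  consider "k = 0" | "k = 1" | j where "k = Suc (Suc j)" by (cases k rule: cheb_U.cases) auto
  then show ?case
  proof cases
    case 1
    then show ?thesis
      using step ge zagier_poly_0[OF n] abs_poly_cheb_U_le[of 0 n] abs_poly_cheb_U_le[of 1 n] by (simp add: abs_le_iff)
  next
    case 2
    then show ?thesis
      using step ge zagier_poly_half[OF n] abs_poly_cheb_U_le[of "1 / 2" n] abs_poly_cheb_U_le[of "3 / 2" n] by (simp add: abs_le_iff)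
  next
    case 3
    then have "zagier_poly n (real k / 2) \<ge> real n / 2 - 2"
      using 1[rule_format, of j] by (simp add: add_divide_distrib add.commute)
    then show ?thesis using step ge by simp
  qed
qed

text \<open>If the value at 0 recurs at p \<ge> 1, clearing denominators makes \<open>w p\<close> a
  multiple of 4^p. Oddness of \<open>w\<close> would be too strong a condition: at x = 1/2 the
  numerators are 2 modulo 4.\<close>

lemma not_periodic_dyadic:
  fixes a :: "nat \<Rightarrow> real" and w :: "nat \<Rightarrow> int"
  assumes a: "\<And>n. 2 ^ (2 * n + 1) * a n = of_int (w n)" and w: "\<And>n. \<not> 4 dvd w n"
  shows "\<not> periodic_seq a"
proof
  assume "periodic_seq a"
  then obtain p where p: "p \<ge> 1" "\<forall>n. a (n + p) = a n"
    unfolding periodic_seq_def by blast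
  have "real_of_int (w p) = 2 ^ (2 * p) * (2 ^ (2 * 0 + 1) * a 0)"
    using p(2)[rule_format, of 0] a[of p] by (simp add: power_add)
  also have "\<dots> = of_int (4 ^ p * w 0)"
    unfolding a by (simp add: power_mult)
  finally have "w p = 4 ^ p * w 0" by (simp only: of_int_eq_iff)
  then have "4 dvd w p" using p(1) by (simp add: dvd_power)
  with w show False by blast
qed

lemma not_periodic_minus_half: "\<not> periodic_seq (\<lambda>n. zagier_poly (2 * n + 1) (- 1 / 2))"
proof (rule not_periodic_dyadic)
  fix n
  show "2 ^ (2 * n + 1) * zagier_poly (2 * n + 1) (- 1 / 2) = of_int (cheb_U_num 1 (2 * n + 1))"
    using poly_cheb_U_half[of "2 * n + 1" 1] by (subst zagier_poly_minus_half) simp_all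
  show "\<not> 4 dvd cheb_U_num 1 (2 * n + 1)"
    using cheb_U_num_mod_4[of 1 "2 * n + 1"] by presburger
qed

lemma not_periodic_half: "\<not> periodic_seq (\<lambda>n. zagier_poly (2 * n + 1) (1 / 2))"
proof (rule not_periodic_dyadic)
  fix n
  show "2 ^ (2 * n + 1) * zagier_poly (2 * n + 1) (1 / 2) =
      of_int (cheb_U_num 1 (2 * n + 1) + cheb_U_num 3 (2 * n + 1))"
    using poly_cheb_U_half[of "2 * n + 1" 1] poly_cheb_U_half[of "2 * n + 1" 3]
    by (subst zagier_poly_half) (simp_all add: ring_distribs)
  show "\<not> 4 dvd cheb_U_num 1 (2 * n + 1) + cheb_U_num 3 (2 * n + 1)"
    using cheb_U_num_mod_4[of 1 "2 * n + 1"] cheb_U_num_mod_4[of 3 "2 * n + 1"] by presburger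
qed

lemma not_periodic_ge_1: "\<not> periodic_seq (\<lambda>n. zagier_poly (2 * n + 1) (real k / 2 + 1))"
proof
  assume "periodic_seq (\<lambda>n. zagier_poly (2 * n + 1) (real k / 2 + 1))"
  then obtain M where M: "\<And>n. \<bar>zagier_poly (2 * n + 1) (real k / 2 + 1)\<bar> \<le> M"
    using periodic_seq_bounded by blast
  obtain n :: nat where "real n > M + 2" using reals_Archimedean2 by blast
  then show False
    using abs_le_D1[OF M[of n]] zagier_poly_odd_lower_bound[of "2 * n + 1" k] by (simp add: field_simps)
qed

text \<open>Here \<open>k\<close> is twice the distance of the argument from the centre of
  reflection -3/2; the values 0, 1, 3 are the arguments -3/2, -1, 0.\<close>

lemma periodic_nonneg:
  assumes "periodic_seq (\<lambda>n. zagier_poly (2 * n + 1) (real k / 2 - 3 / 2))"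
  shows "k \<in> {0, 1, 3}"
proof (rule ccontr)
  assume "k \<notin> {0, 1, 3}"
  then consider "k = 2" | "k = 4" | "k \<ge> 5" by force
  then show False
  proof cases
    case 1
    then show False using assms not_periodic_minus_half by simp
  next
    case 2
    then show False using assms not_periodic_half by simp
  next
    case 3
    then have "real k / 2 - 3 / 2 = real (k - 5) / 2 + 1" by (simp add: field_simps)
    then show False using assms not_periodic_ge_1 by metis
  qed
qed

lemma periodic_imp_half_integer:
  assumes "periodic_seq (\<lambda>n. zagier_poly (2 * n + 1) x)"
  shows "\<exists>k::int. x = of_int k / 2 - 3 / 2"
proof -
  obtain M where M: "\<And>n. \<bar>zagier_poly (2 * n + 1) x\<bar> \<le> M"
    using periodic_seq_bounded[OF assms] by blast
  have "\<bar>bern_fun (x + 2) (cheb_U n)\<bar> \<le> 2 * M" if "odd n" for n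
    using M[of "n div 2"] that by (simp add: zagier_poly_odd)
  then obtain k :: int where "2 * (x + 2) = of_int k"
    using bounded_imp_half_integer by blast
  then have "x = of_int (k - 1) / 2 - 3 / 2" by (simp add: field_simps)
  then show ?thesis by blast
qed

theorem theorem1p2:
  fixes x :: real
  shows "(periodic_seq (\<lambda>n. zagier_poly (2 * n + 1) x) \<longrightarrow> x \<in> {-3, -2, -1, 0} \<or> x = - 3 / 2)
    \<and> (\<forall>n. zagier_poly (2 * n + 1) (- 3 / 2) = 0)"
proof (intro conjI impI allI)
  fix n
  show "zagier_poly (2 * n + 1) (- 3 / 2) = 0" by (rule zagier_poly_odd_center) simp
next
  assume per: "periodic_seq (\<lambda>n. zagier_poly (2 * n + 1) x)"
  then obtain k :: int where k: "x = of_int k / 2 - 3 / 2"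
    using periodic_imp_half_integer by blast
  \<comment> \<open>The reflection replaces \<open>k\<close> by \<open>-k\<close> and only changes
    the sign of the sequence, so periodicity survives.\<close>
  have "periodic_seq (\<lambda>n. zagier_poly (2 * n + 1) (real (nat \<bar>k\<bar>) / 2 - 3 / 2))"
  proof (cases "k \<ge> 0")
    case True
    then show ?thesis using per k by simp
  next
    case False
    then have "real (nat \<bar>k\<bar>) / 2 - 3 / 2 = - 3 - x" by (simp add: k)
    then show ?thesis using per by (simp add: zagier_poly_odd_reflect periodic_seq_def)
  qed
  then have "nat \<bar>k\<bar> \<in> {0, 1, 3}" by (rule periodic_nonneg)
  then have "k \<in> {-3, -1, 0, 1, 3}" by auto
  then show "x \<in> {-3, -2, -1, 0} \<or> x = - 3 / 2" unfolding k by auto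
qed

end
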